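(* Let $D$ be an integral domain with field of fractions $K$ and let $E$ be a nonempty subset of $K$. Let $\star_1$ be a finite type star operation on $D$ and $\star_2$ a finite type star operation on $\operatorname{Int}^{R}(E,D)$. Let $\Lambda\subseteq\operatorname{Spec}(D)$ be such that $\mathfrak{p}^{\star_1}\subsetneq D$ for each $\mathfrak{p}\in\Lambda$ and such that $\star_1\text{-}\operatorname{Max}(D)$ is contained in the ultrafilter closure of $\Lambda$. Let $\Pi=\{\mathfrak{P}_{\mathfrak{p},a}\mid\mathfrak{p}\in\Lambda,\ a\in E\}$ and assume that every ideal in $\Pi$ is a $\star_2$-prime ideal. For $\varphi\in\operatorname{Int}^{R}(E,D)$ put $\chi_\varphi=\{\mathfrak{P}_{\mathfrak{p},a}\in\Pi\mid\varphi\in\mathfrak{P}_{\mathfrak{p},a}\}$, and for an ideal $I\subseteq\operatorname{Int}^{R}(E,D)$ put $\chi_I=\{\chi_\varphi\mid\varphi\in I\}$. Then the following are equivalent: (1) $\chi_I$ has the finite intersection property for all ideals $I\subseteq\operatorname{Int}^{R}(E,D)$ such that $I^{\star_2}\subsetneq\operatorname{Int}^{R}(E,D)$. (2) $\chi_I$ has the finite intersection property for all finitely generated ideals $I$ of $\operatorname{Int}^{R}(E,D)$ such that $I^{\star_2}\subsetneq\operatorname{Int}^{R}(E,D)$. (3) $\star_2\text{-}\operatorname{Max}(\operatorname{Int}^{R}(E,D))$ is contained in the ultrafilter closure of $\Pi$. (4) $\operatorname{Int}^{R}(E,D)$ has the $(\star_1,\star_2)$-Skolem property.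
   Context: $\operatorname{Int}^{R}(E,D)=\{\varphi\in K(x)\mid \varphi(a)\in D \text{ for all } a\in E\}$. For $a\in E$, $\mathfrak{p}\in\operatorname{Spec}(D)$: $\mathfrak{P}_{\mathfrak{p},a}=\{\varphi\in\operatorname{Int}^{R}(E,D)\mid\varphi(a)\in\mathfrak{p}\}$, a prime ideal. For an ideal $I$ of $\operatorname{Int}^{R}(E,D)$ and $a\in E$, $I(a)=\{\varphi(a)\mid\varphi\in I\}$, an ideal of $D$. Star operations: for a domain $R$ with field of fractions $L$, let $F(R)$ be the set of nonzero fractional ideals. A star operation on $R$ is a map $F(R)\to F(R)$, $I\mapsto I^\star$, such that for all nonzero $a\in L$ and $I,J\in F(R)$: $(a)^\star=(a)$ and $(aI)^\star=aI^\star$; $I\subseteq I^\star$, and $I\subseteq J$ implies $I^\star\subseteq J^\star$; $(I^\star)^\star=I^\star$. Convention: $(0)^\star=(0)$, so the zero ideal counts as a $\star$-ideal. An ideal $I$ is a $\star$-ideal if $I^\star=I$. A $\star$-prime is a prime ideal that is a $\star$-ideal; a $\star$-maximal ideal is an ideal maximal among proper integral $\star$-ideals of $R$, and $\star\text{-}\operatorname{Max}(R)$ is the set of these. $\star$ is of finite type if for every $I\in F(R)$, $I^\star=\bigcup J^\star$, the union over all nonzero finitely generated fractional ideals $J\subseteq I$. $\operatorname{Int}^{R}(E,D)$ has the $(\star_1,\star_2)$-Skolem property if every finitely generated ideal $I\subseteq\operatorname{Int}^{R}(E,D)$ with $I(a)^{\star_1}=D$ for each $a\in E$ satisfies $I^{\star_2}=\operatorname{Int}^{R}(E,D)$.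 Ultrafilter closure: for a commutative ring $R$, $X\subseteq\operatorname{Spec}(R)$ and an ultrafilter $\mathcal{U}$ on the set $X$, the ultrafilter limit is the prime ideal $\lim_{\mathcal{U}}X=\{r\in R\mid\{\mathfrak{p}\in X\mid r\in\mathfrak{p}\}\in\mathcal{U}\}$; the ultrafilter closure of $X$ is the set of all ultrafilter limits of $X$. A collection of sets has the finite intersection property if every finite subcollection has nonempty intersection. *)

theory Defs
  imports "HOL-Algebra.Ideal" "HOL-Computational_Algebra.Polynomial"
    "HOL-Computational_Algebra.Fraction_Field"
begin

text \<open>
  A domain is given as a subset \<open>R\<close> of a field type, with the operations of that field.  The
  record \<open>subring_of R\<close> makes the ideal theory of HOL-Algebra available for it; in particular
  \<open>domain (subring_of R)\<close> says that \<open>R\<close> is a subring (with the same \<open>1\<close>).  The field type may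
  be larger than the field of fractions \<open>frac_field R\<close>.
\<close>

definition subring_of :: "'f::field set \<Rightarrow> 'f ring" where
  "subring_of R = \<lparr>carrier = R, monoid.mult = (*), one = 1, zero = 0, add = (+)\<rparr>"

definition frac_field :: "'f::field set \<Rightarrow> 'f set" where
  "frac_field R = {a / b | a b. a \<in> R \<and> b \<in> R \<and> b \<noteq> 0}"

definition Spec :: "'f::field set \<Rightarrow> 'f set set" where
  "Spec R = {P. primeideal P (subring_of R)}"

definition fg_ideal :: "'f::field set \<Rightarrow> 'f set \<Rightarrow> bool" where
  "fg_ideal R I \<longleftrightarrow> (\<exists>S. finite S \<and> S \<subseteq> R \<and> I = genideal (subring_of R) S)"

definition fractional_ideal :: "'f::field set \<Rightarrow> 'f set \<Rightarrow> bool" where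
  "fractional_ideal R I \<longleftrightarrow>
     I \<subseteq> frac_field R \<and> 0 \<in> I \<and> (\<forall>x\<in>I. \<forall>y\<in>I. x + y \<in> I) \<and> (\<forall>r\<in>R. \<forall>x\<in>I. r * x \<in> I) \<and>
     (\<exists>d\<in>R. d \<noteq> 0 \<and> (\<forall>x\<in>I. d * x \<in> R))"

definition nz_fractional_ideals :: "'f::field set \<Rightarrow> 'f set set" where
  "nz_fractional_ideals R = {I. fractional_ideal R I \<and> I \<noteq> {0}}"

definition frac_span :: "'f::field set \<Rightarrow> 'f set \<Rightarrow> 'f set" where
  "frac_span R S = {\<Sum>s\<in>S. c s * s | c. \<forall>s\<in>S. c s \<in> R}"

definition fg_nz_fractional_ideals :: "'f::field set \<Rightarrow> 'f set set" where
  "fg_nz_fractional_ideals R =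
     {J \<in> nz_fractional_ideals R. \<exists>S. finite S \<and> S \<subseteq> frac_field R \<and> J = frac_span R S}"

text \<open>
  A star operation is a total function on sets.  Its values matter only on the nonzero fractional
  ideals and on \<open>{0}\<close>, where the last clause fixes the convention that the zero ideal is closed.
\<close>

definition star_operation :: "'f::field set \<Rightarrow> ('f set \<Rightarrow> 'f set) \<Rightarrow> bool" where
  "star_operation R star \<longleftrightarrow>
     (\<forall>I\<in>nz_fractional_ideals R. star I \<in> nz_fractional_ideals R) \<and>
     (\<forall>a\<in>frac_field R. a \<noteq> 0 \<longrightarrow> star (frac_span R {a}) = frac_span R {a}) \<and>
     (\<forall>a\<in>frac_field R. \<forall>I\<in>nz_fractional_ideals R. a \<noteq> 0 \<longrightarrow>
        star ((\<lambda>x. a * x) ` I) = (\<lambda>x. a * x) ` star I) \<and>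
     (\<forall>I\<in>nz_fractional_ideals R. I \<subseteq> star I) \<and>
     (\<forall>I\<in>nz_fractional_ideals R. \<forall>J\<in>nz_fractional_ideals R. I \<subseteq> J \<longrightarrow> star I \<subseteq> star J) \<and>
     (\<forall>I\<in>nz_fractional_ideals R. star (star I) = star I) \<and>
     star {0} = {0}"

definition finite_type :: "'f::field set \<Rightarrow> ('f set \<Rightarrow> 'f set) \<Rightarrow> bool" where
  "finite_type R star \<longleftrightarrow>
     (\<forall>I\<in>nz_fractional_ideals R. star I = \<Union>{star J | J. J \<in> fg_nz_fractional_ideals R \<and> J \<subseteq> I})"

definition star_ideal :: "'f::field set \<Rightarrow> ('f set \<Rightarrow> 'f set) \<Rightarrow> 'f set \<Rightarrow> bool" where
  "star_ideal R star I \<longleftrightarrow> ideal I (subring_of R) \<and> star I = I"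

definition star_prime :: "'f::field set \<Rightarrow> ('f set \<Rightarrow> 'f set) \<Rightarrow> 'f set \<Rightarrow> bool" where
  "star_prime R star P \<longleftrightarrow> P \<in> Spec R \<and> star_ideal R star P"

definition star_Max :: "'f::field set \<Rightarrow> ('f set \<Rightarrow> 'f set) \<Rightarrow> 'f set set" where
  "star_Max R star =
     {M. star_ideal R star M \<and> M \<noteq> R \<and>
         (\<forall>J. star_ideal R star J \<and> J \<noteq> R \<and> M \<subseteq> J \<longrightarrow> J = M)}"

text \<open>
  An ultrafilter on the set \<open>X\<close> is rendered as an ultrafilter \<open>U\<close> on the ambient type that
  contains \<open>X\<close>, i.e. \<open>U \<le> principal X\<close>.
\<close>

definition ultrafilter_on :: "'a set \<Rightarrow> 'a filter \<Rightarrow> bool" where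
  "ultrafilter_on X U \<longleftrightarrow>
     U \<noteq> bot \<and> U \<le> principal X \<and> (\<forall>P. eventually P U \<or> eventually (\<lambda>x. \<not> P x) U)"

definition ultrafilter_limit :: "'f::field set \<Rightarrow> 'f set filter \<Rightarrow> 'f set" where
  "ultrafilter_limit R U = {r \<in> R. eventually (\<lambda>P. r \<in> P) U}"

definition ultrafilter_closure :: "'f::field set \<Rightarrow> 'f set set \<Rightarrow> 'f set set" where
  "ultrafilter_closure R X = {ultrafilter_limit R U | U. ultrafilter_on X U}"

text \<open>
  The empty subfamily, whose intersection is \<open>UNIV\<close> here, imposes no condition.
\<close>

definition finite_intersection_property :: "'a set set \<Rightarrow> bool" where
  "finite_intersection_property C \<longleftrightarrow> (\<forall>F. F \<subseteq> C \<and> finite F \<longrightarrow> \<Inter>F \<noteq> {})"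

text \<open>
  The field of rational functions \<open>K(x)\<close> is \<open>'k poly fract\<close>.  A rational function is defined at
  \<open>a\<close> if it can be written with a denominator that does not vanish at \<open>a\<close>.
\<close>

definition defined_at :: "'k::field poly fract \<Rightarrow> 'k \<Rightarrow> bool" where
  "defined_at \<phi> a \<longleftrightarrow> (\<exists>p q. \<phi> = Fract p q \<and> poly q a \<noteq> 0)"

definition rat_eval :: "'k::field poly fract \<Rightarrow> 'k \<Rightarrow> 'k" where
  "rat_eval \<phi> a = (THE y. \<exists>p q. \<phi> = Fract p q \<and> poly q a \<noteq> 0 \<and> y = poly p a / poly q a)"

lemma rat_eval_Fract:
  assumes "poly q a \<noteq> 0"
  shows "rat_eval (Fract p q) a = poly p a / poly q a"
  unfolding rat_eval_def
proof (rule the_equality)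
  fix y assume "\<exists>p' q'. Fract p q = Fract p' q' \<and> poly q' a \<noteq> 0 \<and> y = poly p' a / poly q' a"
  then obtain p' q' where eq: "Fract p q = Fract p' q'" and q': "poly q' a \<noteq> 0"
    and y: "y = poly p' a / poly q' a" by blast
  have "q \<noteq> 0" "q' \<noteq> 0" using assms q' by auto
  then have "p * q' = p' * q" using eq by (simp add: eq_fract)
  then have "poly p a * poly q' a = poly p' a * poly q a" by (metis poly_mult)
  then show "y = poly p a / poly q a" using y assms q' by (metis frac_eq_eq)
qed (use assms in blast)

definition IntR :: "'k::field set \<Rightarrow> 'k set \<Rightarrow> 'k poly fract set" where
  "IntR E D = {\<phi>. \<forall>a\<in>E. defined_at \<phi> a \<and> rat_eval \<phi> a \<in> D}"

definition pointed_prime :: "'k::field set \<Rightarrow> 'k set \<Rightarrow> 'k set \<Rightarrow> 'k \<Rightarrow> 'k poly fract set" where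
  "pointed_prime E D \<pp> a = {\<phi> \<in> IntR E D. rat_eval \<phi> a \<in> \<pp>}"

definition value_ideal :: "'k::field poly fract set \<Rightarrow> 'k \<Rightarrow> 'k set" where
  "value_ideal I a = (\<lambda>\<phi>. rat_eval \<phi> a) ` I"

definition Skolem_property ::
  "'k::field set \<Rightarrow> 'k set \<Rightarrow> ('k set \<Rightarrow> 'k set) \<Rightarrow> ('k poly fract set \<Rightarrow> 'k poly fract set) \<Rightarrow> bool"
  where "Skolem_property E D star1 star2 \<longleftrightarrow>
     (\<forall>I. fg_ideal (IntR E D) I \<and> (\<forall>a\<in>E. star1 (value_ideal I a) = D) \<longrightarrow> star2 I = IntR E D)"

text \<open>\<open>X\<close> stands for the set of prime ideals in which the zero loci are taken.\<close>

definition chi_elem :: "'f::field set set \<Rightarrow> 'f \<Rightarrow> 'f set set" where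
  "chi_elem X \<phi> = {P \<in> X. \<phi> \<in> P}"

definition chi_ideal :: "'f::field set set \<Rightarrow> 'f set \<Rightarrow> 'f set set set" where
  "chi_ideal X I = {chi_elem X \<phi> | \<phi>. \<phi> \<in> I}"

end

theory Submission
  imports Defs
begin

text \<open>
  Write \<open>R = Int\<^sup>R(E,D)\<close>.  The family \<open>\<chi>\<^sub>I\<close> has the finite intersection property exactly when
  every finite subset of \<open>I\<close> lies in a member of \<open>\<Pi>\<close>, and this is what all four conditions are
  compared with.  As the condition only involves finite subsets, and the ideal generated by a finite
  subset of \<open>I\<close> has no larger star closure than \<open>I\<close>, (1) and (2) agree (\<open>FIP_of_FIP_fg\<close>).

  For (1) and (3), finite type is used twice.  It makes a union of a chain of star ideals a star
  ideal, so by Zorn's lemma every ideal with a proper star closure lies in a star maximal one; and it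
  makes an ultrafilter limit of star ideals a star ideal.  Both follow from one observation
  (\<open>star_finite_support\<close>): an element of \<open>I\<^sup>\<star>\<close> lies already in every star ideal that
  contains a certain finite subset of \<open>I\<close>.  If \<open>M\<close> is star maximal and \<open>\<chi>\<^sub>M\<close> has the finite
  intersection property, an ultrafilter on \<open>\<Pi>\<close> containing \<open>\<chi>\<^sub>M\<close> has a limit that contains
  \<open>M\<close>; this limit is a proper star ideal, so by maximality it is \<open>M\<close>.  Conversely, finitely many
  elements of an ultrafilter limit lie together in almost every, hence in some, member of the
  family, which gives (1) for every \<open>I\<close> inside a star maximal ideal.

  For (2) and (4), evaluation at \<open>a\<close> carries the question from \<open>R\<close> to \<open>D\<close>: \<open>S\<close> is contained in
  the pointed prime of \<open>\<pp>\<close> and \<open>a\<close> if and only if the values at \<open>a\<close> of the members of \<open>S\<close>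
  lie in \<open>\<pp>\<close>.  If \<open>I\<close> is generated by \<open>S\<close> and \<open>S\<close> lies in such a prime, then \<open>I(a) \<subseteq> \<pp>\<close>, so
  \<open>I(a)\<close> does not have star closure \<open>D\<close>.  In the other direction, if \<open>I(a)\<close> has a proper star
  closure it lies in a star maximal ideal of \<open>D\<close>, which is an ultrafilter limit of members of
  \<open>\<Lambda>\<close>; so finitely many values lie together in one member of \<open>\<Lambda>\<close>.
\<close>

section \<open>Ideals of a subring of a field\<close>

lemma subring_of_simps [simp]:
  "carrier (subring_of R) = R" "\<one>\<^bsub>subring_of R\<^esub> = 1" "\<zero>\<^bsub>subring_of R\<^esub> = 0"
  "x \<otimes>\<^bsub>subring_of R\<^esub> y = x * y" "x \<oplus>\<^bsub>subring_of R\<^esub> y = x + y"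
  by (simp_all add: subring_of_def)

lemma ring_subring_ofI:
  fixes R :: "'f::field set"
  assumes one: "1 \<in> R" and add: "\<And>x y. x \<in> R \<Longrightarrow> y \<in> R \<Longrightarrow> x + y \<in> R"
    and uminus: "\<And>x. x \<in> R \<Longrightarrow> - x \<in> R" and mult: "\<And>x y. x \<in> R \<Longrightarrow> y \<in> R \<Longrightarrow> x * y \<in> R"
  shows "ring (subring_of R)"
proof -
  have zero: "0 \<in> R" using add[OF one uminus[OF one]] by simp
  have "abelian_group (subring_of R)"
  proof (rule abelian_groupI)
    fix x assume x: "x \<in> carrier (subring_of R)"
    show "\<exists>y\<in>carrier (subring_of R). y \<oplus>\<^bsub>subring_of R\<^esub> x = \<zero>\<^bsub>subring_of R\<^esub>"
      using x uminus by (intro bexI[of _ "- x"]) auto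
  qed (auto simp: zero add algebra_simps)
  moreover have "monoid (subring_of R)"
    by (rule monoidI) (auto simp: one mult algebra_simps)
  ultimately show ?thesis
    by (rule ringI) (auto simp: algebra_simps)
qed

text \<open>
  Closure under negation follows from closure under multiplication by \<open>- 1 \<in> R\<close>.
\<close>
lemma ideal_subring_of_iff:
  assumes "ring (subring_of R)"
  shows "ideal I (subring_of R) \<longleftrightarrow>
    I \<subseteq> R \<and> 0 \<in> I \<and> (\<forall>x\<in>I. \<forall>y\<in>I. x + y \<in> I) \<and> (\<forall>r\<in>R. \<forall>x\<in>I. r * x \<in> I)"
    (is "_ \<longleftrightarrow> ?closed")
proof
  interpret ring "subring_of R" by fact
  have one: "1 \<in> R" using one_closed by simp
  have uminus: "\<ominus>\<^bsub>subring_of R\<^esub> x = - x" "- x \<in> R" if "x \<in> R" for x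
  proof -
    show "\<ominus>\<^bsub>subring_of R\<^esub> x = - x"
      using l_neg[of x] that by (simp add: eq_neg_iff_add_eq_0)
    then show "- x \<in> R" using a_inv_closed[of x] that by simp
  qed
  assume closed: ?closed
  have "- 1 \<in> R" using uminus[OF one] by simp
  then have "- x \<in> I" if "x \<in> I" for x
    using closed that by force
  then have "subgroup I (add_monoid (subring_of R))"
  proof (intro subgroup.intro)
    fix x assume x: "x \<in> I"
    then have "inv\<^bsub>add_monoid (subring_of R)\<^esub> x = - x"
      using uminus(1) closed unfolding a_inv_def by blast
    then show "inv\<^bsub>add_monoid (subring_of R)\<^esub> x \<in> I"
      using \<open>\<And>x. x \<in> I \<Longrightarrow> - x \<in> I\<close>[OF x] by (simp only:)
  qed (use closed in auto)
  moreover have "x * r \<in> I" if "x \<in> I" "r \<in> R" for x r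
    using closed that by (simp add: mult.commute)
  ultimately show "ideal I (subring_of R)"
    using closed by (intro idealI assms) auto
next
  assume "ideal I (subring_of R)"
  then interpret ideal I "subring_of R" .
  show ?closed
    using a_subset additive_subgroup.zero_closed[OF is_additive_subgroup]
      additive_subgroup.a_closed[OF is_additive_subgroup] I_l_closed
    by auto
qed

lemma frac_span_superset:
  assumes "finite S" "0 \<in> R" "1 \<in> R"
  shows "S \<subseteq> frac_span R S"
proof
  fix s assume "s \<in> S"
  (* s is the combination with coefficient 1 at s and 0 elsewhere. *)
  then have "s = (\<Sum>t\<in>S. (if t = s then 1 else 0) * t)"
    using assms(1) by (simp add: if_distrib[of "\<lambda>c. c * _"] cong: if_cong)
  then show "s \<in> frac_span R S"
    unfolding frac_span_def using assms(2,3)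
    by (intro CollectI exI[of _ "\<lambda>t. if t = s then 1 else 0"]) auto
qed

lemma frac_span_subset_ideal:
  assumes "ring (subring_of R)" and I: "ideal I (subring_of R)" and "S \<subseteq> I"
  shows "frac_span R S \<subseteq> I"
proof
  fix x assume "x \<in> frac_span R S"
  then obtain c where x: "x = (\<Sum>s\<in>S. c s * s)" and c: "\<forall>s\<in>S. c s \<in> R"
    by (auto simp: frac_span_def)
  have closed: "0 \<in> I" "\<And>x y. x \<in> I \<Longrightarrow> y \<in> I \<Longrightarrow> x + y \<in> I"
    "\<And>r x. r \<in> R \<Longrightarrow> x \<in> I \<Longrightarrow> r * x \<in> I"
    using I by (auto simp: ideal_subring_of_iff[OF assms(1)])
  have terms: "c s * s \<in> I" if "s \<in> S" for s
    using closed(3) c that \<open>S \<subseteq> I\<close> by blast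
  show "x \<in> I"
    unfolding x using closed terms by (induction S rule: infinite_finite_induct) auto
qed

section \<open>Finite type star operations\<close>

text \<open>
  The star axioms concern nonzero fractional ideals.  In this locale they are transferred to integral
  ideals, with the zero ideal included by means of the convention that it is closed, so that later
  arguments need not treat it separately.
\<close>
locale finite_type_star =
  fixes R :: "'f::field set" and star :: "'f set \<Rightarrow> 'f set"
  assumes ring: "ring (subring_of R)"
    and star: "star_operation R star"
    and finite_type: "finite_type R star"
begin

lemma one_mem: "1 \<in> R" and zero_mem: "0 \<in> R"
  using ring.ring_simprules(6)[OF ring] ring.ring_simprules(2)[OF ring] by simp_all

lemmas ideal_iff = ideal_subring_of_iff[OF ring]

lemma ideal_nz_fractional:
  assumes "ideal I (subring_of R)" "I \<noteq> {0}"
  shows "I \<in> nz_fractional_ideals R"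
proof -
  have "R \<subseteq> frac_field R"
  proof
    fix x assume "x \<in> R"
    then show "x \<in> frac_field R"
      unfolding frac_field_def using one_mem by (intro CollectI exI[of _ x] exI[of _ 1]) simp
  qed
  then show ?thesis
    using assms one_mem
    by (auto simp: nz_fractional_ideals_def fractional_ideal_def ideal_iff intro!: bexI[of _ 1])
qed

lemma star_zero: "star {0} = {0}"
  using star by (simp add: star_operation_def)

lemma subset_star: "ideal I (subring_of R) \<Longrightarrow> I \<subseteq> star I"
  using star ideal_nz_fractional star_zero by (cases "I = {0}") (auto simp: star_operation_def)

lemma star_star: "ideal I (subring_of R) \<Longrightarrow> star (star I) = star I"
  using star ideal_nz_fractional star_zero by (cases "I = {0}") (auto simp: star_operation_def)

lemma star_mono:
  assumes "ideal I (subring_of R)" "ideal J (subring_of R)" "I \<subseteq> J"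
  shows "star I \<subseteq> star J"
proof (cases "I = {0}")
  case True
  then show ?thesis using assms subset_star[OF assms(2)] star_zero by auto
next
  case False
  moreover have "J \<noteq> {0}" using assms False by (auto simp: ideal_iff)
  ultimately show ?thesis
    using assms star ideal_nz_fractional by (auto simp: star_operation_def)
qed

lemma ideal_ring: "ideal R (subring_of R)"
  using ring.oneideal[OF ring] by simp

lemma star_ring: "star R = R"
proof -
  have "frac_span R {1} = R"
    by (auto simp: frac_span_def)
  moreover have "1 \<in> frac_field R"
    unfolding frac_field_def using one_mem by (auto intro!: exI[of _ 1])
  ultimately show ?thesis
    using star unfolding star_operation_def by (metis one_neq_zero)
qed

lemma star_subset: "ideal I (subring_of R) \<Longrightarrow> star I \<subseteq> R"
  using star_mono[OF _ ideal_ring] star_ring by (auto simp: ideal_iff)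

lemma star_ideal_star:
  assumes "ideal I (subring_of R)"
  shows "star_ideal R star (star I)"
proof (cases "I = {0}")
  case True
  then show ?thesis using assms by (simp add: star_ideal_def star_zero)
next
  case False
  then have "star I \<in> nz_fractional_ideals R"
    using star ideal_nz_fractional[OF assms] by (auto simp: star_operation_def)
  then have "ideal (star I) (subring_of R)"
    using star_subset[OF assms]
    by (auto simp: nz_fractional_ideals_def fractional_ideal_def ideal_iff)
  then show ?thesis by (simp add: star_ideal_def star_star[OF assms])
qed

text \<open>
  Finite type gives a finitely generated fractional ideal \<open>J \<subseteq> I\<close> with \<open>x \<in> J\<^sup>\<star>\<close>, and any star
  ideal containing the generators of \<open>J\<close> contains \<open>J\<^sup>\<star>\<close>.  Stating this with a finite set
  removes fractional ideals from everything that follows.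
\<close>
lemma star_finite_support:
  assumes I: "ideal I (subring_of R)" and x: "x \<in> star I"
  obtains S where "finite S" "S \<subseteq> I" "\<And>A. star_ideal R star A \<Longrightarrow> S \<subseteq> A \<Longrightarrow> x \<in> A"
proof (cases "I = {0}")
  case True
  then have "x = 0" using x star_zero by simp
  then show ?thesis
    by (intro that[of "{}"]) (auto simp: star_ideal_def ideal_iff)
next
  case False
  then obtain J where J: "J \<in> fg_nz_fractional_ideals R" "J \<subseteq> I" "x \<in> star J"
    using x finite_type ideal_nz_fractional[OF I] unfolding finite_type_def by blast
  then obtain S where S: "finite S" "J = frac_span R S" and nz: "J \<in> nz_fractional_ideals R"
    by (auto simp: fg_nz_fractional_ideals_def)
  have J_ideal: "ideal J (subring_of R)"
    using nz J(2) I by (auto simp: nz_fractional_ideals_def fractional_ideal_def ideal_iff)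
  show ?thesis
  proof (rule that[of S])
    show "S \<subseteq> I" using frac_span_superset[OF S(1) zero_mem one_mem] S(2) J(2) by auto
    fix A assume A: "star_ideal R star A" "S \<subseteq> A"
    then have "J \<subseteq> A"
      using frac_span_subset_ideal[OF ring] S(2) by (simp add: star_ideal_def)
    then show "x \<in> A"
      using star_mono[OF J_ideal] J(3) A(1) by (auto simp: star_ideal_def)
  qed (fact S(1))
qed

text \<open>
  An element of the closure of the union depends on a finite subset of the union, and in a chain a
  finite subset of the union lies in a single member.
\<close>
lemma star_ideal_chain_Union:
  assumes "C \<noteq> {}" and chain: "subset.chain {J. star_ideal R star J} C"
  shows "star_ideal R star (\<Union>C)"
proof -
  have star_C: "star_ideal R star J" if "J \<in> C" for J
    using chain that by (auto simp: subset_chain_def)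
  then have ideal_C: "ideal J (subring_of R)" if "J \<in> C" for J
    using that by (simp add: star_ideal_def)
  have ideal: "ideal (\<Union>C) (subring_of R)"
    unfolding ideal_iff
  proof (intro conjI ballI)
    fix x y assume "x \<in> \<Union>C" "y \<in> \<Union>C"
    then obtain J where "J \<in> C" "x \<in> J" "y \<in> J"
      using chain unfolding subset_chain_def by blast
    then show "x + y \<in> \<Union>C" using ideal_C by (auto simp: ideal_iff)
  next
    fix r x assume "r \<in> R" "x \<in> \<Union>C"
    then obtain J where "J \<in> C" "x \<in> J" by blast
    then have "r * x \<in> J" using ideal_C \<open>r \<in> R\<close> by (auto simp: ideal_iff)
    then show "r * x \<in> \<Union>C" using \<open>J \<in> C\<close> by blast
  next
    show "\<Union>C \<subseteq> R" using ideal_C unfolding ideal_iff by blast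
  qed (use assms(1) ideal_C in \<open>auto simp: ideal_iff\<close>)
  have "star (\<Union>C) \<subseteq> \<Union>C"
  proof
    fix x assume "x \<in> star (\<Union>C)"
    then obtain S where S: "finite S" "S \<subseteq> \<Union>C"
      "\<And>A. star_ideal R star A \<Longrightarrow> S \<subseteq> A \<Longrightarrow> x \<in> A"
      using star_finite_support[OF ideal] by metis
    then obtain J where "J \<in> C" "S \<subseteq> J"
      using finite_subset_Union_chain[OF S(1,2) assms] by blast
    then show "x \<in> \<Union>C" using S(3) star_C by blast
  qed
  then show ?thesis
    using subset_star[OF ideal] ideal by (auto simp: star_ideal_def)
qed

lemma star_Max_above:
  assumes I: "ideal I (subring_of R)" and proper: "star I \<noteq> R"
  obtains M where "M \<in> star_Max R star" "I \<subseteq> M"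
proof -
  let ?A = "{J. star_ideal R star J \<and> J \<noteq> R \<and> I \<subseteq> J}"
  have one_notin: "1 \<notin> J" if "star_ideal R star J" "J \<noteq> R" for J
    using that by (force simp: star_ideal_def ideal_iff)
  have "\<exists>M\<in>?A. \<forall>J\<in>?A. M \<subseteq> J \<longrightarrow> J = M"
  proof (rule subset_Zorn_nonempty)
    show "?A \<noteq> {}"
      using star_ideal_star[OF I] proper subset_star[OF I] by blast
    fix C assume C: "C \<noteq> {}" "subset.chain ?A C"
    then have "star_ideal R star (\<Union>C)"
      by (intro star_ideal_chain_Union) (auto simp: subset_chain_def)
    moreover have "1 \<notin> \<Union>C"
      using C one_notin by (auto simp: subset_chain_def)
    ultimately show "\<Union>C \<in> ?A"
      using C one_mem by (auto simp: subset_chain_def)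
  qed
  then obtain M where "M \<in> ?A" "\<forall>J\<in>?A. M \<subseteq> J \<longrightarrow> J = M" by blast
  then show ?thesis
    by (intro that[of M]) (auto simp: star_Max_def)
qed

text \<open>
  An element of the closure of the limit depends on a finite set \<open>S\<close> in the limit.  Almost all
  members of \<open>X\<close> contain \<open>S\<close>, and since they are star ideals they contain that element too.
\<close>
lemma star_ideal_ultrafilter_limit:
  assumes U: "ultrafilter_on X U" and X: "\<And>P. P \<in> X \<Longrightarrow> star_ideal R star P"
  shows "star_ideal R star (ultrafilter_limit R U)"
proof -
  have in_X: "eventually (\<lambda>P. P \<in> X) U"
    using U by (auto simp: ultrafilter_on_def le_principal)
  have closed: "P \<subseteq> R \<and> 0 \<in> P \<and> (\<forall>x\<in>P. \<forall>y\<in>P. x + y \<in> P) \<and> (\<forall>r\<in>R. \<forall>x\<in>P. r * x \<in> P)"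
    if "P \<in> X" for P
    using X[OF that] by (auto simp: star_ideal_def ideal_iff)
  have ring_closed: "\<forall>x\<in>R. \<forall>y\<in>R. x + y \<in> R" "\<forall>x\<in>R. \<forall>y\<in>R. x * y \<in> R"
    using ideal_ring by (auto simp: ideal_iff)
  have ideal: "ideal (ultrafilter_limit R U) (subring_of R)"
    unfolding ideal_iff ultrafilter_limit_def
  proof (intro conjI ballI)
    have "eventually (\<lambda>P. 0 \<in> P) U"
      using in_X by eventually_elim (use closed in auto)
    then show "0 \<in> {r \<in> R. eventually (\<lambda>P. r \<in> P) U}" using zero_mem by simp
  next
    fix x y assume x: "x \<in> {r \<in> R. eventually (\<lambda>P. r \<in> P) U}"
      and y: "y \<in> {r \<in> R. eventually (\<lambda>P. r \<in> P) U}"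
    have "eventually (\<lambda>P. x \<in> P) U" "eventually (\<lambda>P. y \<in> P) U" using x y by auto
    with in_X have "eventually (\<lambda>P. x + y \<in> P) U"
      by eventually_elim (use closed in auto)
    then show "x + y \<in> {r \<in> R. eventually (\<lambda>P. r \<in> P) U}"
      using x y ring_closed by auto
  next
    fix r x assume r: "r \<in> R" and x: "x \<in> {r \<in> R. eventually (\<lambda>P. r \<in> P) U}"
    have "eventually (\<lambda>P. x \<in> P) U" using x by auto
    with in_X have "eventually (\<lambda>P. r * x \<in> P) U"
      by eventually_elim (use closed r in auto)
    then show "r * x \<in> {r \<in> R. eventually (\<lambda>P. r \<in> P) U}"
      using r x ring_closed by auto
  qed auto
  have "star (ultrafilter_limit R U) \<subseteq> ultrafilter_limit R U"
  proof
    fix x assume x: "x \<in> star (ultrafilter_limit R U)"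
    obtain S where S: "finite S" "S \<subseteq> ultrafilter_limit R U"
      "\<And>A. star_ideal R star A \<Longrightarrow> S \<subseteq> A \<Longrightarrow> x \<in> A"
      using star_finite_support[OF ideal x] by metis
    have "eventually (\<lambda>P. \<forall>s\<in>S. s \<in> P) U"
      using S(1,2) by (auto simp: eventually_ball_finite_distrib ultrafilter_limit_def)
    with in_X have "eventually (\<lambda>P. x \<in> P) U"
      by eventually_elim (use X S(3) in auto)
    then show "x \<in> ultrafilter_limit R U"
      using x star_subset[OF ideal] by (auto simp: ultrafilter_limit_def)
  qed
  then show ?thesis
    using subset_star[OF ideal] ideal by (auto simp: star_ideal_def)
qed

end

section \<open>Ultrafilters\<close>

text \<open>
  A minimal proper filter below \<open>F\<close> exists by Zorn's lemma, the infimum of a chain of proper filters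
  being proper.  It is an ultrafilter: if \<open>P\<close> is not eventually true, restricting to the complement
  of \<open>P\<close> leaves a proper filter, which by minimality is the same filter.
\<close>
lemma ultrafilter_on_below:
  fixes F :: "'a filter"
  assumes "F \<noteq> bot" "F \<le> principal X"
  obtains U where "ultrafilter_on X U" "U \<le> F"
proof -
  let ?A = "{G. G \<noteq> bot \<and> G \<le> F}"
  have "\<exists>U\<in>?A. \<forall>G\<in>?A. G \<le> U \<longrightarrow> G = U"
  proof (rule predicate_Zorn)
    show "partial_order_on ?A (relation_of (\<lambda>G H. H \<le> G) ?A)"
      by (rule partial_order_on_relation_ofI) auto
    fix C assume "C \<in> Chains (relation_of (\<lambda>G H. H \<le> G) ?A)"
    then have C: "C \<subseteq> ?A" "\<And>G H. G \<in> C \<Longrightarrow> H \<in> C \<Longrightarrow> G \<le> H \<or> H \<le> G"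
      by (auto simp: Chains_def relation_of_def)
    show "\<exists>u\<in>?A. \<forall>G\<in>C. u \<le> G"
    proof (cases "C = {}")
      case True
      then show ?thesis using assms by auto
    next
      case False
      have "\<not> eventually (\<lambda>_. False) (Inf C)"
        using C False by (subst eventually_Inf_base) (auto simp: trivial_limit_def)
      then have "Inf C \<noteq> bot" by (simp add: trivial_limit_def)
      moreover have "Inf C \<le> F" using False C(1) by (auto intro: Inf_lower2)
      ultimately show ?thesis by (auto intro!: bexI[of _ "Inf C"] Inf_lower)
    qed
  qed
  then obtain U where U: "U \<noteq> bot" "U \<le> F" and
    min: "\<And>G. G \<noteq> bot \<Longrightarrow> G \<le> F \<Longrightarrow> G \<le> U \<Longrightarrow> G = U" by blast
  have "eventually (\<lambda>x. \<not> P x) U" if "\<not> eventually P U" for P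
  proof -
    let ?G = "inf U (principal {x. \<not> P x})"
    have "?G \<noteq> bot"
      using that by (simp add: trivial_limit_def eventually_inf_principal)
    then have "?G = U" using U by (intro min) (auto intro: le_infI1)
    then have "U \<le> principal {x. \<not> P x}" by (metis inf.cobounded2)
    then show ?thesis by (simp add: le_principal)
  qed
  then show ?thesis
    using U assms(2) by (intro that[of U]) (auto simp: ultrafilter_on_def)
qed

text \<open>
  The finite intersection property of the sets of those \<open>P \<in> X\<close> that contain a given \<open>\<phi> \<in> M\<close> says that the
  filter they generate is proper, so an ultrafilter refines it.  That \<open>M\<close> is nonempty puts the
  ultrafilter on \<open>X\<close>.
\<close>
lemma ultrafilter_on_FIP:
  assumes "M \<noteq> {}" and fip: "\<And>S. finite S \<Longrightarrow> S \<subseteq> M \<Longrightarrow> S \<noteq> {} \<Longrightarrow> \<exists>P\<in>X. S \<subseteq> P"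
  obtains U where "ultrafilter_on X U" "\<And>\<phi>. \<phi> \<in> M \<Longrightarrow> eventually (\<lambda>P. \<phi> \<in> P) U"
proof -
  let ?F = "INF \<phi>\<in>M. principal {P \<in> X. \<phi> \<in> P}"
  have "?F \<noteq> bot"
  proof (rule INF_filter_not_bot)
    fix S assume S: "S \<subseteq> M" "finite S"
    show "(INF \<phi>\<in>S. principal {P \<in> X. \<phi> \<in> P}) \<noteq> bot"
    proof (cases "S = {}")
      case False
      then obtain P where "P \<in> X" "S \<subseteq> P" using fip S by blast
      then have "(\<Inter>\<phi>\<in>S. {P \<in> X. \<phi> \<in> P}) \<noteq> {}" by auto
      then show ?thesis
        using S(2) by (simp add: INF_principal_finite principal_eq_bot_iff)
    qed (simp add: trivial_limit_def)
  qed
  obtain \<psi> where "\<psi> \<in> M" using assms(1) by blast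
  then have "?F \<le> principal {P \<in> X. \<psi> \<in> P}" by (rule INF_lower)
  also have "\<dots> \<le> principal X" by auto
  finally obtain U where U: "ultrafilter_on X U" "U \<le> ?F"
    by (rule ultrafilter_on_below[OF \<open>?F \<noteq> bot\<close>])
  have "eventually (\<lambda>P. \<phi> \<in> P) U" if "\<phi> \<in> M" for \<phi>
  proof -
    have "U \<le> principal {P \<in> X. \<phi> \<in> P}"
      using U(2) INF_lower[OF that] by (rule order_trans)
    then show ?thesis by (auto simp: le_principal elim: eventually_mono)
  qed
  then show ?thesis using U(1) by (rule that[rotated])
qed

section \<open>Integer-valued rational functions\<close>

lemma
  assumes "defined_at \<phi> a" "defined_at \<psi> a"
  shows defined_at_add: "defined_at (\<phi> + \<psi>) a"
    and rat_eval_add: "rat_eval (\<phi> + \<psi>) a = rat_eval \<phi> a + rat_eval \<psi> a"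
    and defined_at_mult: "defined_at (\<phi> * \<psi>) a"
    and rat_eval_mult: "rat_eval (\<phi> * \<psi>) a = rat_eval \<phi> a * rat_eval \<psi> a"
proof -
  obtain p q p' q' where *: "\<phi> = Fract p q" "poly q a \<noteq> 0" "\<psi> = Fract p' q'" "poly q' a \<noteq> 0"
    using assms by (auto simp: defined_at_def)
  then have "q \<noteq> 0" "q' \<noteq> 0" by auto
  then have sum: "\<phi> + \<psi> = Fract (p * q' + p' * q) (q * q')"
    and prod: "\<phi> * \<psi> = Fract (p * p') (q * q')"
    using * by simp_all
  have nz: "poly (q * q') a \<noteq> 0" using * by simp
  show "defined_at (\<phi> + \<psi>) a" "defined_at (\<phi> * \<psi>) a"
    unfolding defined_at_def using sum prod nz by blast+
  show "rat_eval (\<phi> + \<psi>) a = rat_eval \<phi> a + rat_eval \<psi> a"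
    unfolding sum rat_eval_Fract[OF nz] using * by (simp add: rat_eval_Fract field_simps)
  show "rat_eval (\<phi> * \<psi>) a = rat_eval \<phi> a * rat_eval \<psi> a"
    unfolding prod rat_eval_Fract[OF nz] using * by (simp add: rat_eval_Fract)
qed

lemma defined_at_const: "defined_at (Fract [:c:] 1) a"
  unfolding defined_at_def by (intro exI[of _ "[:c:]"] exI[of _ 1]) simp

lemma rat_eval_const: "rat_eval (Fract [:c:] 1) a = c"
  by (simp add: rat_eval_Fract)

lemma rat_eval_zero: "rat_eval 0 a = 0"
  using rat_eval_const[of 0 a] by (simp add: Zero_fract_def)

lemma const_mem_IntR: "c \<in> D \<Longrightarrow> Fract [:c:] 1 \<in> IntR E D"
  by (simp add: IntR_def defined_at_const rat_eval_const)

lemma ring_IntR: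
  assumes "ring (subring_of D)"
  shows "ring (subring_of (IntR E D))"
proof -
  interpret D: ring "subring_of D" by fact
  have D: "1 \<in> D" "\<And>x y. x \<in> D \<Longrightarrow> y \<in> D \<Longrightarrow> x + y \<in> D" "\<And>x y. x \<in> D \<Longrightarrow> y \<in> D \<Longrightarrow> x * y \<in> D"
    using D.one_closed D.a_closed D.m_closed by simp_all
  have "\<ominus>\<^bsub>subring_of D\<^esub> 1 = - 1"
    using D.l_neg[of 1] D(1) by (simp add: eq_neg_iff_add_eq_0)
  then have minus_one: "- 1 \<in> D"
    using D.a_inv_closed[of 1] D(1) by simp
  have mult: "\<phi> * \<psi> \<in> IntR E D" if "\<phi> \<in> IntR E D" "\<psi> \<in> IntR E D" for \<phi> \<psi>
    using that D by (simp add: IntR_def defined_at_mult rat_eval_mult)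
  show ?thesis
  proof (rule ring_subring_ofI)
    show "1 \<in> IntR E D"
      using const_mem_IntR[OF D(1)] by (simp add: One_fract_def one_pCons)
    fix \<phi> \<psi> assume \<phi>: "\<phi> \<in> IntR E D" and \<psi>: "\<psi> \<in> IntR E D"
    show "\<phi> + \<psi> \<in> IntR E D"
      using \<phi> \<psi> D by (simp add: IntR_def defined_at_add rat_eval_add)
    show "\<phi> * \<psi> \<in> IntR E D" using \<phi> \<psi> mult by blast
  next
    fix \<phi> assume \<phi>: "\<phi> \<in> IntR E D"
    have "Fract [:- 1:] 1 = (- 1 :: 'a poly fract)"
      by (simp add: One_fract_def one_pCons)
    then show "- \<phi> \<in> IntR E D"
      using mult[OF const_mem_IntR[OF minus_one] \<phi>] by simp
  qed
qed

text \<open>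
  Constants from \<open>D\<close> belong to \<open>Int\<^sup>R(E,D)\<close>, so \<open>I(a)\<close> inherits from \<open>I\<close> closure under
  multiplication by elements of \<open>D\<close>.
\<close>
lemma ideal_value_ideal:
  assumes ring: "ring (subring_of D)" and "a \<in> E" and I: "ideal I (subring_of (IntR E D))"
  shows "ideal (value_ideal I a) (subring_of D)"
proof -
  have closed: "I \<subseteq> IntR E D" "0 \<in> I" "\<And>\<phi> \<psi>. \<phi> \<in> I \<Longrightarrow> \<psi> \<in> I \<Longrightarrow> \<phi> + \<psi> \<in> I"
    "\<And>\<rho> \<phi>. \<rho> \<in> IntR E D \<Longrightarrow> \<phi> \<in> I \<Longrightarrow> \<rho> * \<phi> \<in> I"
    using I by (auto simp: ideal_subring_of_iff[OF ring_IntR[OF ring]])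
  have defined: "defined_at \<phi> a" "rat_eval \<phi> a \<in> D" if "\<phi> \<in> I" for \<phi>
    using that closed(1) \<open>a \<in> E\<close> by (auto simp: IntR_def)
  have "0 \<in> value_ideal I a"
    unfolding value_ideal_def using closed(2) rat_eval_zero by (metis imageI)
  moreover have "d * rat_eval \<phi> a \<in> value_ideal I a" if "d \<in> D" "\<phi> \<in> I" for d \<phi>
  proof -
    have "d * rat_eval \<phi> a = rat_eval (Fract [:d:] 1 * \<phi>) a"
      using that defined by (simp only: rat_eval_mult defined_at_const rat_eval_const)
    moreover have "Fract [:d:] 1 * \<phi> \<in> I"
      using closed(4) const_mem_IntR that by blast
    ultimately show ?thesis
      unfolding value_ideal_def by (rule image_eqI)
  qed
  moreover have "rat_eval \<phi> a + rat_eval \<psi> a \<in> value_ideal I a" if "\<phi> \<in> I" "\<psi> \<in> I" for \<phi> \<psi>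
    using that defined closed(3) unfolding value_ideal_def by (metis imageI rat_eval_add)
  ultimately show ?thesis
    using defined by (auto simp: ideal_subring_of_iff[OF ring] value_ideal_def)
qed

lemma ideal_pointed_prime:
  assumes ring: "ring (subring_of D)" and "a \<in> E" and \<pp>: "ideal \<pp> (subring_of D)"
  shows "ideal (pointed_prime E D \<pp> a) (subring_of (IntR E D))"
proof -
  have IntR: "0 \<in> IntR E D" "\<forall>\<phi>\<in>IntR E D. \<forall>\<psi>\<in>IntR E D. \<phi> + \<psi> \<in> IntR E D"
    "\<forall>\<phi>\<in>IntR E D. \<forall>\<psi>\<in>IntR E D. \<phi> * \<psi> \<in> IntR E D"
    using ring.oneideal[OF ring_IntR[OF ring, of E]]
    by (auto simp: ideal_subring_of_iff[OF ring_IntR[OF ring]])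
  have defined: "defined_at \<phi> a" "rat_eval \<phi> a \<in> D" if "\<phi> \<in> IntR E D" for \<phi>
    using that \<open>a \<in> E\<close> by (auto simp: IntR_def)
  show ?thesis
    using \<pp> IntR defined
    by (auto simp: ideal_subring_of_iff[OF ring_IntR[OF ring]] ideal_subring_of_iff[OF ring]
        pointed_prime_def rat_eval_zero rat_eval_add rat_eval_mult)
qed

section \<open>Finite intersections, ultrafilter limits and the Skolem property\<close>

text \<open>
  A finite subfamily of \<open>\<chi>\<^sub>I\<close> comes from a finite \<open>S \<subseteq> I\<close>.  The set \<open>S = {}\<close> is excluded because
  the empty family has intersection \<open>UNIV\<close>, even when \<open>X\<close> is empty.
\<close>
lemma finite_intersection_property_chi_iff:
  "finite_intersection_property (chi_ideal X I) \<longleftrightarrow>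
     (\<forall>S. finite S \<and> S \<subseteq> I \<and> S \<noteq> {} \<longrightarrow> (\<exists>P\<in>X. S \<subseteq> P))"
proof -
  have "finite_intersection_property (chi_ideal X I) \<longleftrightarrow>
      (\<forall>S. S \<subseteq> I \<and> finite S \<longrightarrow> (\<Inter>\<phi>\<in>S. chi_elem X \<phi>) \<noteq> {})"
    unfolding finite_intersection_property_def chi_ideal_def Setcompr_eq_image
    by (simp add: all_finite_subset_image conj_commute) 
  also have "\<dots> \<longleftrightarrow> (\<forall>S. finite S \<and> S \<subseteq> I \<and> S \<noteq> {} \<longrightarrow> (\<exists>P\<in>X. S \<subseteq> P))"
  proof (intro iff_allI)
    fix S
    have "(\<Inter>\<phi>\<in>S. chi_elem X \<phi>) \<noteq> {} \<longleftrightarrow> (\<exists>P\<in>X. S \<subseteq> P)" if "S \<noteq> {}"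
      using that by (auto simp: chi_elem_def)
    then show "(S \<subseteq> I \<and> finite S \<longrightarrow> (\<Inter>\<phi>\<in>S. chi_elem X \<phi>) \<noteq> {}) \<longleftrightarrow>
       (finite S \<and> S \<subseteq> I \<and> S \<noteq> {} \<longrightarrow> (\<exists>P\<in>X. S \<subseteq> P))"
      by (cases "S = {}") auto
  qed
  finally show ?thesis .
qed

text \<open>
  Finitely many sets in an ultrafilter intersect in a set of the ultrafilter, which is nonempty.
\<close>
lemma ultrafilter_limit_subset_element:
  assumes "ultrafilter_on X U" "finite S" "S \<subseteq> ultrafilter_limit R U"
  obtains P where "P \<in> X" "S \<subseteq> P"
proof -
  have "eventually (\<lambda>P. P \<in> X) U" "eventually (\<lambda>P. \<forall>s\<in>S. s \<in> P) U"
    using assms by (auto simp: ultrafilter_on_def le_principal ultrafilter_limit_def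
        eventually_ball_finite_distrib)
  then have "eventually (\<lambda>P. P \<in> X \<and> S \<subseteq> P) U"
    by eventually_elim auto
  then have "\<exists>P. P \<in> X \<and> S \<subseteq> P"
    using assms(1) eventually_happens' unfolding ultrafilter_on_def by blast
  then show ?thesis using that by blast
qed

context finite_type_star
begin

text \<open>
  The ideal \<open>I\<close> lies in a star maximal ideal, hence in an ultrafilter limit, and finitely many elements
  of a limit lie together in one member of \<open>X\<close>.
\<close>
lemma FIP_of_star_Max_in_closure:
  assumes closure: "star_Max R star \<subseteq> ultrafilter_closure R X"
    and I: "ideal I (subring_of R)" "star I \<noteq> R"
  shows "finite_intersection_property (chi_ideal X I)"
proof -
  obtain M where "M \<in> star_Max R star" "I \<subseteq> M" by (rule star_Max_above[OF I])
  then obtain U where U: "ultrafilter_on X U" "I \<subseteq> ultrafilter_limit R U"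
    using closure by (auto simp: ultrafilter_closure_def)
  have "\<exists>P\<in>X. S \<subseteq> P" if "finite S" "S \<subseteq> I" for S
  proof -
    have "S \<subseteq> ultrafilter_limit R U" using that(2) U(2) by simp
    from ultrafilter_limit_subset_element[OF U(1) that(1) this] show ?thesis by metis
  qed
  then show ?thesis by (simp add: finite_intersection_property_chi_iff)
qed

text \<open>
  For a star maximal \<open>M\<close>, the finite intersection property of \<open>\<chi>\<^sub>M\<close> gives an ultrafilter whose limit
  contains \<open>M\<close>; the limit is a proper star ideal, so maximality forces equality.
\<close>
lemma star_Max_in_closure_of_FIP:
  assumes X: "\<And>P. P \<in> X \<Longrightarrow> star_ideal R star P \<and> P \<noteq> R"
    and fip: "\<And>I. ideal I (subring_of R) \<Longrightarrow> star I \<noteq> R \<Longrightarrow> finite_intersection_property (chi_ideal X I)"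
  shows "star_Max R star \<subseteq> ultrafilter_closure R X"
proof
  fix M assume "M \<in> star_Max R star"
  then have M: "star_ideal R star M" "M \<noteq> R"
    and max: "\<And>J. star_ideal R star J \<Longrightarrow> J \<noteq> R \<Longrightarrow> M \<subseteq> J \<Longrightarrow> J = M"
    by (auto simp: star_Max_def)
  have ideal: "ideal M (subring_of R)" using M by (simp add: star_ideal_def)
  have "finite_intersection_property (chi_ideal X M)"
    using M ideal by (intro fip) (auto simp: star_ideal_def)
  moreover have "M \<noteq> {}" "M \<subseteq> R" using ideal by (auto simp: ideal_iff)
  ultimately obtain U where U: "ultrafilter_on X U" "\<And>\<phi>. \<phi> \<in> M \<Longrightarrow> eventually (\<lambda>P. \<phi> \<in> P) U"
    using ultrafilter_on_FIP[of M X] by (metis finite_intersection_property_chi_iff)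
  (* The limit is proper; otherwise a single member of X would contain 1. *)
  have "1 \<notin> ultrafilter_limit R U"
  proof
    assume "1 \<in> ultrafilter_limit R U"
    then obtain P where "P \<in> X" "1 \<in> P"
      using ultrafilter_limit_subset_element[OF U(1), of "{1}" R] by auto
    then show False using X[of P] by (force simp: star_ideal_def ideal_iff)
  qed
  then have "ultrafilter_limit R U = M"
    using U \<open>M \<subseteq> R\<close> one_mem X
    by (intro max star_ideal_ultrafilter_limit[OF U(1)]) (auto simp: ultrafilter_limit_def)
  then show "M \<in> ultrafilter_closure R X"
    using U(1) by (auto simp: ultrafilter_closure_def)
qed

lemma ideal_genideal: "S \<subseteq> R \<Longrightarrow> ideal (genideal (subring_of R) S) (subring_of R)"
  using ring.genideal_ideal[OF ring] by simp

lemma fg_ideal_imp_ideal: "fg_ideal R I \<Longrightarrow> ideal I (subring_of R)"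
  using ideal_genideal by (auto simp: fg_ideal_def)

lemma FIP_of_FIP_fg:
  assumes fip: "\<And>J. fg_ideal R J \<Longrightarrow> star J \<noteq> R \<Longrightarrow> finite_intersection_property (chi_ideal X J)"
    and I: "ideal I (subring_of R)" "star I \<noteq> R"
  shows "finite_intersection_property (chi_ideal X I)"
  unfolding finite_intersection_property_chi_iff
proof (intro allI impI, elim conjE)
  fix S assume S: "finite S" "S \<subseteq> I" "S \<noteq> {}"
  let ?J = "genideal (subring_of R) S"
  have SR: "S \<subseteq> R" using S(2) I(1) by (auto simp: ideal_iff)
  have "fg_ideal R ?J" using S(1) SR by (auto simp: fg_ideal_def)
  moreover have "star ?J \<noteq> R"
  proof -
    have "?J \<subseteq> I" using ring.genideal_minimal[OF ring I(1) S(2)] .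
    then have "star ?J \<subseteq> star I" by (rule star_mono[OF ideal_genideal[OF SR] I(1)])
    then show ?thesis using star_subset[OF I(1)] I(2) by auto
  qed
  ultimately have "finite_intersection_property (chi_ideal X ?J)" by (rule fip)
  moreover have "S \<subseteq> ?J"
    using ring.genideal_self[OF ring] SR by simp
  ultimately show "\<exists>P\<in>X. S \<subseteq> P"
    using S by (auto simp: finite_intersection_property_chi_iff)
qed

end

text \<open>
  If \<open>I\<close> is finitely generated with a proper star closure, its generators lie in one pointed prime,
  so \<open>I\<close> does too, and for the corresponding \<open>\<pp>\<close> and \<open>a\<close> the ideal \<open>I(a)\<close> is contained in \<open>\<pp>\<close>,
  whose star closure is proper.
\<close>
lemma Skolem_of_FIP:
  assumes D: "finite_type_star D star1" and R: "finite_type_star (IntR E D) star2"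
    and \<Lambda>: "\<And>\<pp>. \<pp> \<in> \<Lambda> \<Longrightarrow> ideal \<pp> (subring_of D) \<and> star1 \<pp> \<noteq> D"
    and fip: "\<And>I. fg_ideal (IntR E D) I \<Longrightarrow> star2 I \<noteq> IntR E D \<Longrightarrow>
      finite_intersection_property (chi_ideal {pointed_prime E D \<pp> a | \<pp> a. \<pp> \<in> \<Lambda> \<and> a \<in> E} I)"
  shows "Skolem_property E D star1 star2"
  unfolding Skolem_property_def
proof (intro allI impI, elim conjE, rule ccontr)
  interpret D: finite_type_star D star1 by fact
  interpret R: finite_type_star "IntR E D" star2 by fact
  fix I assume I: "fg_ideal (IntR E D) I" and unit: "\<forall>a\<in>E. star1 (value_ideal I a) = D"
    and "star2 I \<noteq> IntR E D"
  obtain S where S: "finite S" "S \<subseteq> IntR E D" "I = genideal (subring_of (IntR E D)) S"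
    using I by (auto simp: fg_ideal_def)
  have ideal: "ideal I (subring_of (IntR E D))" by (rule R.fg_ideal_imp_ideal[OF I])
  (* Adding 0 gives a nonempty set even if I is generated by the empty set. *)
  have "insert 0 S \<subseteq> I"
    using ideal ring.genideal_self[OF R.ring] S by (auto simp: R.ideal_iff)
  then obtain \<pp> a where \<pp>: "\<pp> \<in> \<Lambda>" "a \<in> E" and S_sub: "insert 0 S \<subseteq> pointed_prime E D \<pp> a"
    using fip[OF I \<open>star2 I \<noteq> IntR E D\<close>] S(1) unfolding finite_intersection_property_chi_iff
    by blast
  have \<pp>_ideal: "ideal \<pp> (subring_of D)" and \<pp>_proper: "star1 \<pp> \<noteq> D" using \<Lambda>[OF \<pp>(1)] by auto
  have "I \<subseteq> pointed_prime E D \<pp> a"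
    unfolding S(3) using S_sub
    by (intro ring.genideal_minimal[OF R.ring] ideal_pointed_prime[OF D.ring \<pp>(2) \<pp>_ideal]) auto
  then have "value_ideal I a \<subseteq> \<pp>"
    by (auto simp: value_ideal_def pointed_prime_def)
  then have "star1 (value_ideal I a) \<subseteq> star1 \<pp>"
    by (intro D.star_mono ideal_value_ideal[OF D.ring \<pp>(2) ideal] \<pp>_ideal)
  then show False
    using unit \<pp>(2) \<pp>_proper D.star_subset[OF \<pp>_ideal] by auto
qed

text \<open>
  The Skolem property provides a point \<open>a\<close> where \<open>I(a)\<close> has a proper star closure, hence lies in a
  star maximal ideal of \<open>D\<close>.  That ideal is an ultrafilter limit of members of \<open>\<Lambda>\<close>, so finitely
  many values at \<open>a\<close> of members of \<open>I\<close> lie in a common \<open>\<pp> \<in> \<Lambda>\<close>.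
\<close>
lemma FIP_of_Skolem:
  assumes D: "finite_type_star D star1" and R: "finite_type_star (IntR E D) star2"
    and closure: "star_Max D star1 \<subseteq> ultrafilter_closure D \<Lambda>"
    and skolem: "Skolem_property E D star1 star2"
    and I: "fg_ideal (IntR E D) I" "star2 I \<noteq> IntR E D"
  shows "finite_intersection_property (chi_ideal {pointed_prime E D \<pp> a | \<pp> a. \<pp> \<in> \<Lambda> \<and> a \<in> E} I)"
  unfolding finite_intersection_property_chi_iff
proof (intro allI impI, elim conjE)
  interpret D: finite_type_star D star1 by fact
  interpret R: finite_type_star "IntR E D" star2 by fact
  fix S assume S: "finite S" "S \<subseteq> I"
  have ideal: "ideal I (subring_of (IntR E D))" by (rule R.fg_ideal_imp_ideal[OF I(1)])
  obtain a where a: "a \<in> E" "star1 (value_ideal I a) \<noteq> D"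
    using skolem I by (auto simp: Skolem_property_def)
  obtain M where "M \<in> star_Max D star1" "value_ideal I a \<subseteq> M"
    by (rule D.star_Max_above[OF ideal_value_ideal[OF D.ring a(1) ideal] a(2)])
  then obtain U where U: "ultrafilter_on \<Lambda> U" "value_ideal I a \<subseteq> ultrafilter_limit D U"
    using closure by (auto simp: ultrafilter_closure_def)
  have "(\<lambda>\<phi>. rat_eval \<phi> a) ` S \<subseteq> ultrafilter_limit D U"
    using S(2) U(2) by (auto simp: value_ideal_def)
  then obtain \<pp> where "\<pp> \<in> \<Lambda>" "(\<lambda>\<phi>. rat_eval \<phi> a) ` S \<subseteq> \<pp>"
    by (rule ultrafilter_limit_subset_element[OF U(1) finite_imageI[OF S(1)]])
  moreover have "S \<subseteq> IntR E D" using S(2) ideal by (auto simp: R.ideal_iff)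
  ultimately have "S \<subseteq> pointed_prime E D \<pp> a" by (auto simp: pointed_prime_def)
  then show "\<exists>P\<in>{pointed_prime E D \<pp> a | \<pp> a. \<pp> \<in> \<Lambda> \<and> a \<in> E}. S \<subseteq> P"
    using \<open>\<pp> \<in> \<Lambda>\<close> a(1) by blast
qed

theorem theorem4p4:
  fixes D E :: "'k::field set"
    and star1 :: "'k set \<Rightarrow> 'k set"
    and star2 :: "'k poly fract set \<Rightarrow> 'k poly fract set"
    and \<Lambda> :: "'k set set"
    and PP :: "'k poly fract set set"
  assumes "domain (subring_of D)"
    and "frac_field D = UNIV"
    and "E \<noteq> {}"
    and "star_operation D star1" and "finite_type D star1"
    and "star_operation (IntR E D) star2" and "finite_type (IntR E D) star2"
    and "\<Lambda> \<subseteq> Spec D"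
    and "\<forall>\<pp>\<in>\<Lambda>. star1 \<pp> \<subset> D"
    and "star_Max D star1 \<subseteq> ultrafilter_closure D \<Lambda>"
    and "PP = {pointed_prime E D \<pp> a | \<pp> a. \<pp> \<in> \<Lambda> \<and> a \<in> E}"
    and "\<forall>P\<in>PP. star_prime (IntR E D) star2 P"
  shows
    "((\<forall>I. ideal I (subring_of (IntR E D)) \<and> star2 I \<subset> IntR E D
          \<longrightarrow> finite_intersection_property (chi_ideal PP I))
      \<longleftrightarrow>
      (\<forall>I. fg_ideal (IntR E D) I \<and> star2 I \<subset> IntR E D
          \<longrightarrow> finite_intersection_property (chi_ideal PP I)))
     \<and>
     ((\<forall>I. fg_ideal (IntR E D) I \<and> star2 I \<subset> IntR E D
          \<longrightarrow> finite_intersection_property (chi_ideal PP I))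
      \<longleftrightarrow>
      star_Max (IntR E D) star2 \<subseteq> ultrafilter_closure (IntR E D) PP)
     \<and>
     (star_Max (IntR E D) star2 \<subseteq> ultrafilter_closure (IntR E D) PP
      \<longleftrightarrow>
      Skolem_property E D star1 star2)"
proof -
  let ?R = "IntR E D"
  let ?fip = "\<lambda>I. finite_intersection_property (chi_ideal PP I)"
  have D_ring: "ring (subring_of D)"
    using assms(1) by (simp add: domain_def cring_def)
  interpret D: finite_type_star D star1
    using D_ring assms(4,5) by (rule finite_type_star.intro)
  interpret R: finite_type_star ?R star2
    using ring_IntR[OF D_ring] assms(6,7) by (rule finite_type_star.intro)
  have psubset_iff: "star2 I \<subset> ?R \<longleftrightarrow> star2 I \<noteq> ?R" if "ideal I (subring_of ?R)" for I
    using R.star_subset[OF that] by blast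
  have PP: "star_ideal ?R star2 P \<and> P \<noteq> ?R" if "P \<in> PP" for P
    using assms(12) that primeideal.I_notcarr[of P "subring_of ?R"]
    by (auto simp: star_prime_def Spec_def)
  have \<Lambda>: "ideal \<pp> (subring_of D) \<and> star1 \<pp> \<noteq> D" if "\<pp> \<in> \<Lambda>" for \<pp>
    using assms(8,9) that primeideal.axioms(1) by (fastforce simp: Spec_def)
  define one where "one \<longleftrightarrow> (\<forall>I. ideal I (subring_of ?R) \<and> star2 I \<noteq> ?R \<longrightarrow> ?fip I)"
  define two where "two \<longleftrightarrow> (\<forall>I. fg_ideal ?R I \<and> star2 I \<noteq> ?R \<longrightarrow> ?fip I)"
  define three where "three \<longleftrightarrow> star_Max ?R star2 \<subseteq> ultrafilter_closure ?R PP"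
  have "one = two"
    unfolding one_def two_def using R.fg_ideal_imp_ideal R.FIP_of_FIP_fg[of PP] by blast
  moreover have "one = three"
    unfolding one_def three_def
    using R.FIP_of_star_Max_in_closure[of PP] R.star_Max_in_closure_of_FIP[of PP] PP by blast
  moreover have "two = Skolem_property E D star1 star2"
  proof
    assume two
    then show "Skolem_property E D star1 star2"
      unfolding two_def assms(11)
      by (intro Skolem_of_FIP[OF D.finite_type_star_axioms R.finite_type_star_axioms \<Lambda>]) auto
  next
    assume "Skolem_property E D star1 star2"
    then show two
      unfolding two_def assms(11)
      using FIP_of_Skolem[OF D.finite_type_star_axioms R.finite_type_star_axioms assms(10)] by blast
  qed
  moreover have "one \<longleftrightarrow> (\<forall>I. ideal I (subring_of ?R) \<and> star2 I \<subset> ?R \<longrightarrow> ?fip I)"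
    unfolding one_def using psubset_iff by blast
  moreover have "two \<longleftrightarrow> (\<forall>I. fg_ideal ?R I \<and> star2 I \<subset> ?R \<longrightarrow> ?fip I)"
    unfolding two_def using psubset_iff R.fg_ideal_imp_ideal by blast
  ultimately show ?thesis
    unfolding three_def by blast
qed

end
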